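(* Let $\lambda>1$ be a natural number. The rattleback system $$\dot x=\lambda xz,\qquad \dot y=-yz,\qquad \dot z=y^2-\lambda x^2$$ can be written in the Lax form $\dot L=[L,B]$, where $[L,B]:=LB-BL$ and $$L=\begin{bmatrix} 0 & -x+y\sqrt{\lambda} & x\sqrt{\lambda}+y\\ x-y\sqrt{\lambda} & 0 & z\sqrt{\lambda+1}\\ -x\sqrt{\lambda}-y & -z\sqrt{\lambda+1} & 0\end{bmatrix},$$ $$B=\begin{bmatrix} 0 & (-x\sqrt{\lambda}+y)\sqrt{\lambda+1} & 0\\ (x\sqrt{\lambda}-y)\sqrt{\lambda+1} & 0 & z\sqrt{\lambda}\\ 0 & -z\sqrt{\lambda} & 0\end{bmatrix}.$$
   Context: Writing the system in the Lax form $\dot L=[L,B]$ means that a curve $t\mapsto(x(t),y(t),z(t))$ solves the system if and only if the matrix-valued curves obtained by substituting it in $L$ and $B$ satisfy $\dot L=LB-BL$. *)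

theory Defs
  imports "HOL-Analysis.Analysis"
begin

definition commutator :: "real^'n^'n \<Rightarrow> real^'n^'n \<Rightarrow> real^'n^'n" where
  "commutator L B = L ** B - B ** L"

text \<open>
  Solutions live on a set of times \<open>I\<close>, in practice an interval; the derivative is taken within
  \<open>I\<close>, so it is the ordinary derivative at interior points and one-sided at end points.
\<close>

definition rattleback_solution ::
    "real \<Rightarrow> real set \<Rightarrow> (real \<Rightarrow> real) \<Rightarrow> (real \<Rightarrow> real) \<Rightarrow> (real \<Rightarrow> real) \<Rightarrow> bool" where
  "rattleback_solution l I x y z \<longleftrightarrow>
     (\<forall>t\<in>I.
        (x has_real_derivative l * x t * z t) (at t within I) \<and>
        (y has_real_derivative - (y t * z t)) (at t within I) \<and>
        (z has_real_derivative (y t)\<^sup>2 - l * (x t)\<^sup>2) (at t within I))"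

definition lax_solution ::
    "real set \<Rightarrow> (real \<Rightarrow> real^'n^'n) \<Rightarrow> (real \<Rightarrow> real^'n^'n) \<Rightarrow> bool" where
  "lax_solution I L B \<longleftrightarrow>
     (\<forall>t\<in>I. (L has_vector_derivative commutator (L t) (B t)) (at t within I))"

definition rattleback_L :: "real \<Rightarrow> real \<Rightarrow> real \<Rightarrow> real \<Rightarrow> real^3^3" where
  "rattleback_L l x y z = vector
     [vector [0, - x + y * sqrt l, x * sqrt l + y],
      vector [x - y * sqrt l, 0, z * sqrt (l + 1)],
      vector [- x * sqrt l - y, - z * sqrt (l + 1), 0]]"

definition rattleback_B :: "real \<Rightarrow> real \<Rightarrow> real \<Rightarrow> real \<Rightarrow> real^3^3" where
  "rattleback_B l x y z = vector
     [vector [0, (- x * sqrt l + y) * sqrt (l + 1), 0],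
      vector [(x * sqrt l - y) * sqrt (l + 1), 0, z * sqrt l],
      vector [0, - z * sqrt l, 0]]"

end

theory Submission
  imports Defs
begin

text \<open>
  The entries of \<open>L\<close> depend linearly on \<open>(x, y, z)\<close>, so along a differentiable curve the
  derivative of \<open>L\<close> is \<open>L\<close> evaluated at the velocity. A direct computation shows that \<open>[L, B]\<close> at
  a point is \<open>L\<close> evaluated at the rattleback vector field there
  (\<open>commutator_rattleback_L_B\<close>). Hence the Lax equation says that the velocity and the vector
  field have the same image under \<open>L\<close>.

  That the Lax equation implies the system needs more than this: its hypothesis is only that the
  matrix curve is differentiable. The point is that the linear map \<open>(x, y, z) \<mapsto> L\<close> is injective
  when \<open>l \<ge> 0\<close>, with an explicit linear left inverse that recovers the coordinates from three
  matrix entries. Composing with the left inverse gives differentiability of the coordinates along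
  with their derivatives (\<open>rattleback_L_has_vector_derivative_iff\<close>).
\<close>

lemma has_vector_derivative_vec_nth:
  assumes "(f has_vector_derivative f') F"
  shows "((\<lambda>t. f t $ i) has_vector_derivative f' $ i) F"
  using bounded_linear.has_vector_derivative[OF bounded_linear_vec_nth assms] .

lemma has_real_derivative_matrix_entry:
  fixes M :: "real \<Rightarrow> real^'n^'m"
  assumes "(M has_vector_derivative M') (at t within I)"
  shows "((\<lambda>t. M t $ i $ j) has_real_derivative M' $ i $ j) (at t within I)"
  using has_vector_derivative_vec_nth[OF has_vector_derivative_vec_nth[OF assms]]
  by (simp add: has_real_derivative_iff_has_vector_derivative)

lemma rattleback_L_linear_combination:
  "rattleback_L l x y z =
     x *\<^sub>R rattleback_L l 1 0 0 + y *\<^sub>R rattleback_L l 0 1 0 + z *\<^sub>R rattleback_L l 0 0 1"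
  by (simp add: rattleback_L_def vec_eq_iff forall_3 vector_3 algebra_simps)

text \<open>
  The matrix entries \<open>a = - x + y \<surd>l\<close> and \<open>b = x \<surd>l + y\<close> are the image of \<open>(x, y)\<close> under a matrix
  of determinant \<open>- (l + 1)\<close>, and a third entry is a nonzero multiple of \<open>z\<close>.
\<close>

lemma coordinates_from_rattleback_L:
  assumes "l \<ge> 0"
  shows "x = (sqrt l * rattleback_L l x y z $ 1 $ 3 - rattleback_L l x y z $ 1 $ 2) / (l + 1)"
    and "y = (sqrt l * rattleback_L l x y z $ 1 $ 2 + rattleback_L l x y z $ 1 $ 3) / (l + 1)"
    and "z = rattleback_L l x y z $ 2 $ 3 / sqrt (l + 1)"
proof -
  have s: "sqrt l * sqrt l = l" and n: "l + 1 \<noteq> 0"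
    using assms by auto
  have "sqrt l * (x * sqrt l + y) - (- x + y * sqrt l) = x * (sqrt l * sqrt l + 1)"
    and "sqrt l * (- x + y * sqrt l) + (x * sqrt l + y) = y * (sqrt l * sqrt l + 1)"
    by algebra+
  then show "x = (sqrt l * rattleback_L l x y z $ 1 $ 3 - rattleback_L l x y z $ 1 $ 2) / (l + 1)"
    and "y = (sqrt l * rattleback_L l x y z $ 1 $ 2 + rattleback_L l x y z $ 1 $ 3) / (l + 1)"
    unfolding s using n by (simp_all add: rattleback_L_def vector_3)
  show "z = rattleback_L l x y z $ 2 $ 3 / sqrt (l + 1)"
    using n by (simp add: rattleback_L_def vector_3)
qed

lemma rattleback_L_has_vector_derivative_iff:
  assumes "l \<ge> 0"
  shows "((\<lambda>t. rattleback_L l (x t) (y t) (z t)) has_vector_derivative rattleback_L l x' y' z')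
           (at t within I) \<longleftrightarrow>
         (x has_real_derivative x') (at t within I) \<and>
         (y has_real_derivative y') (at t within I) \<and>
         (z has_real_derivative z') (at t within I)"
    (is "?lhs \<longleftrightarrow> ?rhs")
proof
  assume ?rhs
  then show ?lhs
    unfolding rattleback_L_linear_combination[of l "x _" "y _" "z _"]
      rattleback_L_linear_combination[of l x' y' z']
    by (auto intro!: derivative_eq_intros)
next
  assume L: ?lhs
  define M where "M t = rattleback_L l (x t) (y t) (z t)" for t
  define M' where "M' = rattleback_L l x' y' z'"
  have entry: "((\<lambda>t. M t $ i $ j) has_real_derivative M' $ i $ j) (at t within I)" for i j
    using has_real_derivative_matrix_entry[OF L] by (simp add: M_def M'_def)
  have coords:
    "x = (\<lambda>t. (sqrt l * M t $ 1 $ 3 - M t $ 1 $ 2) / (l + 1))"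
    "y = (\<lambda>t. (sqrt l * M t $ 1 $ 2 + M t $ 1 $ 3) / (l + 1))"
    "z = (\<lambda>t. M t $ 2 $ 3 / sqrt (l + 1))"
    unfolding M_def by (intro ext coordinates_from_rattleback_L[OF assms])+
  have velocities:
    "x' = (sqrt l * M' $ 1 $ 3 - M' $ 1 $ 2) / (l + 1)"
    "y' = (sqrt l * M' $ 1 $ 2 + M' $ 1 $ 3) / (l + 1)"
    "z' = M' $ 2 $ 3 / sqrt (l + 1)"
    unfolding M'_def by (intro coordinates_from_rattleback_L[OF assms])+
  have "((\<lambda>t. (sqrt l * M t $ 1 $ 3 - M t $ 1 $ 2) / (l + 1)) has_real_derivative x')
          (at t within I)"
    and "((\<lambda>t. (sqrt l * M t $ 1 $ 2 + M t $ 1 $ 3) / (l + 1)) has_real_derivative y')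
          (at t within I)"
    and "((\<lambda>t. M t $ 2 $ 3 / sqrt (l + 1)) has_real_derivative z') (at t within I)"
    unfolding velocities by (intro DERIV_cdivide DERIV_cmult DERIV_diff DERIV_add entry)+
  then show ?rhs
    unfolding coords[symmetric] by blast
qed

text \<open>
  Both matrices are skew-symmetric, hence so is their commutator, and three entries matter. The
  squares \<open>(\<surd>l)\<^sup>2 = l\<close> and \<open>(\<surd>(l + 1))\<^sup>2 = l + 1\<close> are all that is needed to match them.
\<close>

lemma commutator_rattleback_L_B:
  assumes "l \<ge> 0"
  shows "commutator (rattleback_L l x y z) (rattleback_B l x y z) =
    rattleback_L l (l * x * z) (- (y * z)) (y\<^sup>2 - l * x\<^sup>2)"
proof -
  define s where "s = sqrt l"
  define r where "r = sqrt (l + 1)"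
  have l: "l = s * s" and r: "r * r = s * s + 1"
    using assms by (auto simp: s_def r_def)
  have r_left: "r * (r * w) = (s * s + 1) * w" for w
    by (simp flip: r)
  show ?thesis
    unfolding commutator_def rattleback_L_def rattleback_B_def s_def[symmetric] r_def[symmetric]
    by (simp add: vec_eq_iff forall_3 matrix_matrix_mult_def sum_3 vector_3)
      (simp add: l r r_left power2_eq_square algebra_simps)
qed

theorem proposition8p1:
  fixes l :: nat and I :: "real set" and x y z :: "real \<Rightarrow> real"
  assumes "l > 1" and "is_interval I"
  shows "rattleback_solution (real l) I x y z \<longleftrightarrow>
    lax_solution I
      (\<lambda>t. rattleback_L (real l) (x t) (y t) (z t))
      (\<lambda>t. rattleback_B (real l) (x t) (y t) (z t))"
  unfolding rattleback_solution_def lax_solution_def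
  by (simp add: commutator_rattleback_L_B rattleback_L_has_vector_derivative_iff)

end
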